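(* Let $(\mathsf H,L)$ be a canonical system with $\operatorname{rank}\mathsf H(x)=1$ for a.e. $x\in[0,L]$. 1. If $\mathsf H\in C^\alpha[0,L]$, $0<\alpha\le1$, then the order of the system is not greater than $1-\alpha/2$. 2. If $\mathsf H$ has bounded variation on $[0,L]$, then the order of the system is not greater than $1/2$.
   Context: Canonical systems. Let $L>0$ and let $\mathsf H$ be a summable function on $[0,L]$ with values in real symmetric $2\times2$ matrices such that $\mathsf H(x)\ge0$ and $\operatorname{tr}\mathsf H(x)=1$ for a.e. $x$. Let $J=\begin{pmatrix}0&-1\\1&0\end{pmatrix}$. The canonical system $(\mathsf H,L)$ is the equation $J\frac{dY}{dx}=z\mathsf H Y$, $z\in\mathbb C$, $x\in[0,L]$; $\mathsf H$ is called its Hamiltonian. Its matrix solution with $M(0,z)=I$ is denoted $M(x,z)$, and $M(z):=M(L,z)$ is the monodromy matrix, an entire matrix function of $z$. Order. The quantity $\limsup_{|z|\to\infty}\frac{\log\log|M_{ij}(z)|}{\log|z|}$ (the order of the entire function $M_{ij}$) does not depend on $i,j$ and is called the order of the system; it equals the order of the entire matrix function $M(z)$, i.e. $\limsup_{|z|\to\infty}\frac{\log\log\|M(z)\|}{\log|z|}$ with $\|\cdot\|$ the operator norm (polynomials having order $0$). $C^\alpha[0,L]$ denotes the Hölder class with exponent $\alpha$: $\|\mathsf H(x)-\mathsf H(y)\|\le \mathrm{const}\,|x-y|^\alpha$ for all $x,y\in[0,L]$ (for $\alpha=1$, Lipschitz functions). *)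

theory Defs
  imports "HOL-Analysis.Analysis"
begin

definition hoelder_on :: "real \<Rightarrow> real set \<Rightarrow> (real \<Rightarrow> 'a::real_normed_vector) \<Rightarrow> bool" where
  "hoelder_on \<alpha> S f \<longleftrightarrow> (\<exists>C. \<forall>x\<in>S. \<forall>y\<in>S. norm (f x - f y) \<le> C * \<bar>x - y\<bar> powr \<alpha>)"

text \<open>
  The members of a division of a subset of the line are nonempty compact intervals
  \<open>k = {Inf k..Sup k}\<close> with pairwise disjoint interiors. Degenerate members contribute \<open>0\<close>
  to the sums below.
\<close>

definition bounded_variation_on :: "real \<Rightarrow> real \<Rightarrow> (real \<Rightarrow> 'a::real_normed_vector) \<Rightarrow> bool" where
  "bounded_variation_on a b f \<longleftrightarrow>
    (\<exists>B. \<forall>d. d division_of {a..b} \<longrightarrow> (\<Sum>k\<in>d. norm (f (Sup k) - f (Inf k))) \<le> B)"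

definition abs_continuous_on :: "real \<Rightarrow> real \<Rightarrow> (real \<Rightarrow> 'a::real_normed_vector) \<Rightarrow> bool" where
  "abs_continuous_on a b f \<longleftrightarrow>
    (\<forall>\<epsilon>>0. \<exists>\<delta>>0. \<forall>d S. d division_of S \<and> S \<subseteq> {a..b} \<and> (\<Sum>k\<in>d. Sup k - Inf k) < \<delta> \<longrightarrow>
      (\<Sum>k\<in>d. norm (f (Sup k) - f (Inf k))) < \<epsilon>)"

definition hamiltonian :: "(real \<Rightarrow> real^2^2) \<Rightarrow> real \<Rightarrow> bool" where
  "hamiltonian H L \<longleftrightarrow>
    H absolutely_integrable_on {0..L} \<and>
    (\<forall>x\<in>{0..L}. transpose (H x) = H x) \<and>
    (AE x in lebesgue_on {0..L}. (\<forall>v. 0 \<le> v \<bullet> (H x *v v)) \<and> trace (H x) = 1)"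

definition J :: "complex^2^2" where
  "J = vector [vector [0, -1], vector [1, 0]]"

definition cmatrix :: "real^2^2 \<Rightarrow> complex^2^2" where
  "cmatrix A = (\<chi> i j. complex_of_real (A $ i $ j))"

text \<open>
  Since \<open>H\<close> is only summable, \<open>J Y' = z H Y\<close> is understood in the sense of Caratheodory:
  \<open>Y\<close> is absolutely continuous and the equation holds almost everywhere.
\<close>

definition canonical_solution ::
  "(real \<Rightarrow> real^2^2) \<Rightarrow> real \<Rightarrow> complex \<Rightarrow> (real \<Rightarrow> complex^2) \<Rightarrow> bool" where
  "canonical_solution H L z Y \<longleftrightarrow>
    abs_continuous_on 0 L Y \<and>
    (AE x in lebesgue_on {0..L}. \<exists>Y'.
      (Y has_vector_derivative Y') (at x within {0..L}) \<and>
      J *v Y' = z *s (cmatrix (H x) *v Y x))"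

definition matrix_solution ::
  "(real \<Rightarrow> real^2^2) \<Rightarrow> real \<Rightarrow> (real \<Rightarrow> complex \<Rightarrow> complex^2^2) \<Rightarrow> bool" where
  "matrix_solution H L M \<longleftrightarrow>
    (\<forall>z. M 0 z = mat 1 \<and> (\<forall>j. canonical_solution H L z (\<lambda>x. column j (M x z))))"

text \<open>
  \<open>growth_order g\<close> is the limsup of \<open>log log (g z) / log \<bar>z\<bar>\<close> at infinity. Both outer logarithms
  are truncated to \<open>log\<^sup>+\<close>: otherwise small values of \<open>g\<close> (for instance near the zeros of an
  entire function) would contribute, because \<^const>\<open>ln\<close> satisfies \<open>ln (- t) = ln t\<close>.
  With the truncation every polynomial, including the constants, has order \<open>0\<close>.
\<close>

definition ln_plus :: "real \<Rightarrow> real" where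
  "ln_plus t = ln (max 1 t)"

definition growth_order :: "(complex \<Rightarrow> real) \<Rightarrow> ereal" where
  "growth_order g = Limsup at_infinity (\<lambda>z. ereal (ln_plus (ln_plus (g z)) / ln (norm z)))"

definition entire_order :: "(complex \<Rightarrow> complex) \<Rightarrow> ereal" where
  "entire_order f = growth_order (\<lambda>z. norm (f z))"

text \<open>
  The operator norm is taken here, not \<^const>\<open>norm\<close>, which on matrices is the Frobenius norm.
\<close>

definition matrix_order :: "(complex \<Rightarrow> complex^2^2) \<Rightarrow> ereal" where
  "matrix_order A = growth_order (\<lambda>z. onorm (\<lambda>v. A z *v v))"

end

(*
Divide [0,L] into N equal parts of length h = L/N and let V_k bound the oscillation of H on the
k-th part. There H is, up to V_k, a fixed projection e e^T. In the frame (e, J e), rescaled by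
s and 1/s, the system has a coefficient of size at most |z| (1/s^2 + s^2 V_k^2): the projection
itself is nilpotent after multiplication by J, so only the rescaled off-diagonal entry 1/s^2 and the
quadratic error remain. With s^2 = max 1 (1/(V_k + 1/N)) this is at most |z| (2 V_k + 1/N), while
entering and leaving the frame costs a factor s^2 <= N. Hence
  log |M| <= N (1 + log N) + 2 |z| h (2 sum V_k + 1).
If sum V_k <= C N^(1-b), the choice N ~ |z|^(1/(1+b)) bounds the order by 1/(1+b). For Hoelder
coefficients b = alpha and 1/(1+alpha) <= 1 - alpha/2; for bounded variation b = 1.
*)
theory Submission
  imports Defs "HOL-Real_Asymp.Real_Asymp"
begin

section \<open>Absolute continuity: mean value inequality and Gronwall bound\<close>

lemma abs_continuous_on_linear_image:
  assumes "abs_continuous_on a b f" and T: "bounded_linear T"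
  shows "abs_continuous_on a b (\<lambda>x. T (f x))"
  unfolding abs_continuous_on_def
proof (intro allI impI)
  fix \<epsilon> :: real assume "\<epsilon> > 0"
  interpret bounded_linear T by fact
  obtain C where "C > 0" and C: "\<And>x. norm (T x) \<le> norm x * C"
    using pos_bounded by blast
  with \<open>\<epsilon> > 0\<close> have "\<epsilon> / C > 0" by simp
  with assms(1) obtain \<delta> where "\<delta> > 0" and \<delta>:
    "\<forall>d S. d division_of S \<and> S \<subseteq> {a..b} \<and> (\<Sum>k\<in>d. Sup k - Inf k) < \<delta> \<longrightarrow>
      (\<Sum>k\<in>d. norm (f (Sup k) - f (Inf k))) < \<epsilon> / C"
    unfolding abs_continuous_on_def by blast
  show "\<exists>\<delta>>0. \<forall>d S. d division_of S \<and> S \<subseteq> {a..b} \<and> (\<Sum>k\<in>d. Sup k - Inf k) < \<delta> \<longrightarrow>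
      (\<Sum>k\<in>d. norm (T (f (Sup k)) - T (f (Inf k)))) < \<epsilon>"
  proof (intro exI[of _ \<delta>] conjI allI impI)
    fix d S assume d: "d division_of S \<and> S \<subseteq> {a..b} \<and> (\<Sum>k\<in>d. Sup k - Inf k) < \<delta>"
    have "(\<Sum>k\<in>d. norm (T (f (Sup k)) - T (f (Inf k))))
        \<le> (\<Sum>k\<in>d. norm (f (Sup k) - f (Inf k))) * C"
      unfolding sum_distrib_right by (intro sum_mono) (metis C diff)
    also have "\<dots> < \<epsilon>"
      using \<delta>[rule_format, of d S] d \<open>C > 0\<close> by (simp add: pos_less_divide_eq)
    finally show "(\<Sum>k\<in>d. norm (T (f (Sup k)) - T (f (Inf k)))) < \<epsilon>" .
  qed fact
qed

text \<open>Forgetting the tags merges terms only when two tags carry the same interval. Its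
  interior is then disjoint from itself, so the interval is a single point and \<open>g\<close>
  vanishes on it.\<close>

lemma tagged_partial_sum_image:
  fixes g :: "real set \<Rightarrow> real"
  assumes p: "p tagged_partial_division_of i"
    and g: "\<And>c. g {c} = 0"
  shows "(\<Sum>(x, k)\<in>p. g k) = (\<Sum>k\<in>snd ` p. g k)"
proof -
  have "(\<Sum>k\<in>snd ` p. g k) = (\<Sum>t\<in>p. g (snd t))"
  proof (subst sum.reindex_nontrivial)
    show "finite p" by (rule tagged_partial_division_ofD(1)[OF p])
    fix s t assume st: "s \<in> p" "t \<in> p" "s \<noteq> t" "snd s = snd t"
    then have "interior (snd s) = {}"
      using tagged_partial_division_ofD(5)[OF p, of "fst s" "snd s" "fst t" "snd t"]
      by (metis Int_absorb prod.collapse)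
    moreover obtain u v where "snd s = {u..v}" "fst s \<in> snd s"
      using tagged_partial_division_ofD(2,4)[OF p, of "fst s" "snd s"] st(1) by auto
    ultimately have "snd s = {u}" by (auto simp: interior_atLeastAtMost_real)
    then show "g (snd s) = 0" by (simp add: g)
  qed (simp add: o_def)
  then show ?thesis by (simp add: split_beta')
qed

text \<open>
  A gauge fine enough to see the derivative off \<open>E\<close>, and to keep the intervals tagged
  in \<open>E\<close> inside an open set of small measure, where absolute continuity controls the increments.
\<close>
lemma abs_continuous_mean_value:
  fixes Y :: "real \<Rightarrow> 'a::real_normed_vector"
  assumes ac: "abs_continuous_on A B Y" and sub: "{a..b} \<subseteq> {A..B}" and "a \<le> b"
    and E: "negligible E"
    and der: "\<And>x. x \<in> {a..b} - E \<Longrightarrow>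
      \<exists>Y'. (Y has_vector_derivative Y') (at x within {a..b}) \<and> norm Y' \<le> K"
  shows "norm (Y b - Y a) \<le> K * (b - a)"
proof -
  have main: "norm (Y b - Y a) \<le> (K + \<epsilon>) * (b - a) + \<epsilon>"
    if "0 < \<epsilon>" and K: "0 \<le> K" for \<epsilon>
  proof -
    obtain \<delta> where "\<delta> > 0" and \<delta>:
      "\<And>d S. d division_of S \<Longrightarrow> S \<subseteq> {A..B} \<Longrightarrow> (\<Sum>k\<in>d. Sup k - Inf k) < \<delta> \<Longrightarrow>
        (\<Sum>k\<in>d. norm (Y (Sup k) - Y (Inf k))) < \<epsilon>"
      using ac \<open>0 < \<epsilon>\<close> unfolding abs_continuous_on_def by meson
    obtain U where U: "open U" "E \<subseteq> U" "U - E \<in> lmeasurable" "emeasure lebesgue (U - E) < ennreal \<delta>"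
      using sets_lebesgue_outer_open[of E \<delta>] E \<open>\<delta> > 0\<close> negligible_imp_sets by metis
    have Um: "U \<in> lmeasurable" "measure lebesgue U < \<delta>"
    proof -
      have "U = (U - E) \<union> E" using U by auto
      then show "U \<in> lmeasurable"
        using U(3) negligible_imp_measurable[OF E] fmeasurable.Un by metis
      have "measure lebesgue U = measure lebesgue (U - E)"
        using E by (metis \<open>U \<in> lmeasurable\<close> fmeasurableD measure_Diff_null_set negligible_iff_null_sets)
      also have "\<dots> < \<delta>"
        using U(3,4) \<open>\<delta> > 0\<close> by (simp add: emeasure_eq_measure2 ennreal_less_iff)
      finally show "measure lebesgue U < \<delta>" .
    qed
    \<comment> \<open>The radius of the gauge at \<open>x\<close>. At points of
      \<open>{a..b} - E\<close> the estimate compares endpoints on the two sides of the tag (the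
      straddle lemma), since the tag need not be an endpoint of its interval.\<close>
    have "\<exists>r>0. (x \<in> E \<longrightarrow> ball x r \<subseteq> U) \<and>
        (x \<in> {a..b} - E \<longrightarrow> (\<forall>u\<in>{a..x}. \<forall>v\<in>{x..b}. u \<in> ball x r \<longrightarrow> v \<in> ball x r \<longrightarrow>
          norm (Y v - Y u) \<le> (K + \<epsilon>) * (v - u)))" for x
    proof (cases "x \<in> {a..b} - E")
      case True
      then obtain Y' where Y': "(Y has_vector_derivative Y') (at x within {a..b})" "norm Y' \<le> K"
        using der by blast
      then obtain r where "r > 0" and r: "\<And>y. y \<in> {a..b} \<Longrightarrow> norm (y - x) < r \<Longrightarrow>
          norm (Y y - Y x - (y - x) *\<^sub>R Y') \<le> \<epsilon> * norm (y - x)"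
        using \<open>0 < \<epsilon>\<close> unfolding has_vector_derivative_def has_derivative_within_alt by blast
      have "norm (Y v - Y u) \<le> (K + \<epsilon>) * (v - u)"
        if "u \<in> {a..x}" "v \<in> {x..b}" "u \<in> ball x r" "v \<in> ball x r" for u v
      proof -
        have "Y v - Y u = (Y v - Y x - (v - x) *\<^sub>R Y') - (Y u - Y x - (u - x) *\<^sub>R Y') + (v - u) *\<^sub>R Y'"
          by (simp add: algebra_simps)
        also have "norm \<dots> \<le> norm (Y v - Y x - (v - x) *\<^sub>R Y') +
            norm (Y u - Y x - (u - x) *\<^sub>R Y') + norm ((v - u) *\<^sub>R Y')"
          by (intro norm_triangle_mono norm_triangle_ineq4 order_refl)
        also have "\<dots> \<le> \<epsilon> * (v - x) + \<epsilon> * (x - u) + (v - u) * K"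
        proof (intro add_mono)
          show "norm ((v - u) *\<^sub>R Y') \<le> (v - u) * K"
            using that Y'(2) by (auto intro: mult_left_mono)
        qed (use r[of v] r[of u] that True in \<open>auto simp: dist_real_def\<close>)
        also have "\<dots> = (K + \<epsilon>) * (v - u)" by (simp add: algebra_simps)
        finally show ?thesis .
      qed
      then show ?thesis using \<open>r > 0\<close> True by blast
    next
      case False
      then show ?thesis using U(1,2) by (metis gt_ex open_contains_ball subsetD)
    qed
    then obtain r where r0: "\<And>x. r x > 0" and rU: "\<And>x. x \<in> E \<Longrightarrow> ball x (r x) \<subseteq> U"
      and rd: "\<And>x u v. x \<in> {a..b} - E \<Longrightarrow> u \<in> {a..x} \<Longrightarrow> v \<in> {x..b} \<Longrightarrow>
        u \<in> ball x (r x) \<Longrightarrow> v \<in> ball x (r x) \<Longrightarrow> norm (Y v - Y u) \<le> (K + \<epsilon>) * (v - u)"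
      by metis
    obtain p where p: "p tagged_division_of {a..b}" "(\<lambda>x. ball x (r x)) fine p"
      using fine_division_exists_real[OF gauge_ball_dependent] r0 by metis
    have fin: "finite p" using p(1) by auto
    have pk: "\<exists>u v. k = {u..v} \<and> a \<le> u \<and> u \<le> x \<and> x \<le> v \<and> v \<le> b" if xk: "(x, k) \<in> p" for x k
    proof -
      obtain u v where "k = cbox u v" using p(1) xk by blast
      moreover have "x \<in> k" "k \<subseteq> {a..b}" using p(1) xk by blast+
      ultimately show ?thesis by (auto intro!: exI[of _ u] exI[of _ v])
    qed
    define q where "q = {t \<in> p. fst t \<in> E}"
    have q: "q tagged_partial_division_of {a..b}"
      using p(1) unfolding q_def tagged_division_of_def
      by (auto intro: tagged_partial_division_subset)
    have qd: "(snd ` q) division_of \<Union>(snd ` q)"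
      using q by (rule partial_division_of_tagged_division)
    have SU: "\<Union>(snd ` q) \<subseteq> U"
      using p(2) rU unfolding q_def fine_def by force
    \<comment> \<open>Members of a division do not overlap, so their total length is the measure of
      their union, which lies in \<open>U\<close>. This makes absolute continuity applicable to the
      intervals tagged in \<open>E\<close>.\<close>
    have len: "(\<Sum>k\<in>snd ` q. Sup k - Inf k) < \<delta>"
    proof -
      have "(\<Sum>k\<in>snd ` q. Sup k - Inf k) = (\<Sum>k\<in>snd ` q. measure lebesgue k)"
        using pk by (intro sum.cong) (force simp: q_def)+
      also have "\<dots> = measure lebesgue (\<Union>(snd ` q))"
        by (rule content_division[OF qd])
      also have "\<dots> \<le> measure lebesgue U"
        using lmeasurable_division[OF qd] Um(1) SU by (intro measure_mono_fmeasurable) auto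
      finally show ?thesis using Um(2) by simp
    qed
    have sq: "(\<Sum>(x, k)\<in>q. norm (Y (Sup k) - Y (Inf k))) < \<epsilon>"
      by (subst tagged_partial_sum_image[OF q], simp)
        (use \<delta>[OF qd _ len] tagged_partial_division_ofD(3)[OF q] sub in fastforce)
    have "Y b - Y a = (\<Sum>(x, k)\<in>p. Y (Sup k) - Y (Inf k))"
      using additive_tagged_division_1[OF \<open>a \<le> b\<close> p(1), of Y] by simp
    also have "norm \<dots> \<le> (\<Sum>t\<in>p. norm (Y (Sup (snd t)) - Y (Inf (snd t))))"
      unfolding split_beta' by (rule norm_sum)
    \<comment> \<open>Keeping the length term also for tags in \<open>E\<close> is harmless because
      \<open>K + \<epsilon>\<close> is nonnegative, and it lets the lengths add up to
      \<open>b - a\<close>.\<close>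
    also have "\<dots> \<le> (\<Sum>t\<in>p. (K + \<epsilon>) * (Sup (snd t) - Inf (snd t)) +
        (if t \<in> q then norm (Y (Sup (snd t)) - Y (Inf (snd t))) else 0))"
    proof (rule sum_mono)
      fix t assume t: "t \<in> p"
      then obtain u v where uv: "snd t = {u..v}" "a \<le> u" "u \<le> fst t" "fst t \<le> v" "v \<le> b"
        using pk[of "fst t" "snd t"] by auto
      have "snd t \<subseteq> ball (fst t) (r (fst t))"
        using fineD[OF p(2), of "fst t" "snd t"] t by simp
      moreover have "u \<in> snd t" "v \<in> snd t" using uv by auto
      ultimately have "u \<in> ball (fst t) (r (fst t))" "v \<in> ball (fst t) (r (fst t))"
        by blast+
      then have "norm (Y v - Y u) \<le> (K + \<epsilon>) * (v - u)" if "t \<notin> q"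
        using rd[of "fst t" u v] uv that t by (auto simp: q_def)
      then show "norm (Y (Sup (snd t)) - Y (Inf (snd t))) \<le> (K + \<epsilon>) * (Sup (snd t) - Inf (snd t)) +
          (if t \<in> q then norm (Y (Sup (snd t)) - Y (Inf (snd t))) else 0)"
        using uv K \<open>0 < \<epsilon>\<close> by auto
    qed
    also have "\<dots> = (K + \<epsilon>) * (\<Sum>(x, k)\<in>p. Sup k - Inf k) + (\<Sum>(x, k)\<in>q. norm (Y (Sup k) - Y (Inf k)))"
      using fin by (simp add: sum.distrib sum_distrib_left split_beta' q_def sum.inter_filter)
    also have "(\<Sum>(x, k)\<in>p. Sup k - Inf k) = b - a"
      using additive_tagged_division_1[OF \<open>a \<le> b\<close> p(1), of "\<lambda>x. x"] by simp
    finally show ?thesis using sq by simp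
  qed
  show ?thesis
  proof (cases "a = b")
    case False
    \<comment> \<open>A nondegenerate interval is not negligible, so some point off \<open>E\<close>
      has a derivative of norm at most \<open>K\<close>.\<close>
    have "0 \<le> K"
    proof -
      have "\<not> {a..b} \<subseteq> E"
        using negligible_subset[OF E, of "cbox a b"] \<open>a \<le> b\<close> False
        unfolding negligible_interval by auto
      then show ?thesis using der by (meson DiffI norm_ge_zero order_trans subsetI)
    qed
    show ?thesis
    proof (rule field_le_epsilon)
      fix e :: real assume "e > 0"
      \<comment> \<open>The bound \<open>main\<close> loses
        \<open>\<epsilon> * (b - a) + \<epsilon>\<close>; with this value of \<epsilon> the loss is
        exactly \<open>e\<close>.\<close>
      then have e': "e / (b - a + 1) > 0" using \<open>a \<le> b\<close> by simp
      have "norm (Y b - Y a) \<le> K * (b - a) + e / (b - a + 1) * (b - a + 1)"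
        using main[OF e' \<open>0 \<le> K\<close>] by (simp only: ring_distribs)
      then show "norm (Y b - Y a) \<le> K * (b - a) + e" using \<open>a \<le> b\<close> by simp
    qed
  qed simp
qed

lemma abs_continuous_imp_continuous:
  fixes f :: "real \<Rightarrow> 'a::real_normed_vector"
  assumes "abs_continuous_on a b f"
  shows "continuous_on {a..b} f"
  unfolding continuous_on_iff
proof (intro ballI allI impI)
  fix x \<epsilon> :: real assume x: "x \<in> {a..b}" and "\<epsilon> > 0"
  with assms obtain \<delta> where "\<delta> > 0" and \<delta>:
    "\<forall>d S. d division_of S \<and> S \<subseteq> {a..b} \<and> (\<Sum>k\<in>d. Sup k - Inf k) < \<delta> \<longrightarrow>
      (\<Sum>k\<in>d. norm (f (Sup k) - f (Inf k))) < \<epsilon>"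
    unfolding abs_continuous_on_def by blast
  have close: "norm (f v - f u) < \<epsilon>" if "a \<le> u" "u \<le> v" "v \<le> b" "v - u < \<delta>" for u v
    using \<delta>[rule_format, of "{{u..v}}" "{u..v}"] division_of_self[of u v] that by simp
  show "\<exists>r>0. \<forall>y\<in>{a..b}. dist y x < r \<longrightarrow> dist (f y) (f x) < \<epsilon>"
  proof (intro exI[of _ \<delta>] conjI ballI impI)
    fix y assume "y \<in> {a..b}" "dist y x < \<delta>"
    then show "dist (f y) (f x) < \<epsilon>"
      using close[of x y] close[of y x] x by (cases "x \<le> y") (auto simp: dist_norm norm_minus_commute)
  qed fact
qed

text \<open>At the point \<open>t\<close> where the norm of \<open>Z\<close> is largest, the mean
  value inequality bounds the increment since \<open>a\<close> by one half of that largest norm. The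
  maximum is therefore at most twice the initial norm.\<close>

lemma abs_continuous_short_growth:
  fixes Z :: "real \<Rightarrow> 'a::real_normed_vector"
  assumes ac: "abs_continuous_on A B Z" and sub: "{a..b} \<subseteq> {A..B}" and "a \<le> b"
    and E: "negligible E"
    and der: "\<And>x. x \<in> {a..b} - E \<Longrightarrow>
      \<exists>Z'. (Z has_vector_derivative Z') (at x within {a..b}) \<and> norm Z' \<le> \<rho> * norm (Z x)"
    and \<rho>: "0 \<le> \<rho>" "\<rho> * (b - a) \<le> 1 / 2"
  shows "norm (Z b) \<le> 2 * norm (Z a)"
proof -
  have "continuous_on {a..b} (\<lambda>x. norm (Z x))"
    using abs_continuous_imp_continuous[OF ac] sub
    by (auto intro: continuous_on_norm continuous_on_subset)
  then obtain t where t: "t \<in> {a..b}" and max: "\<And>x. x \<in> {a..b} \<Longrightarrow> norm (Z x) \<le> norm (Z t)"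
    using continuous_attains_sup[of "{a..b}" "\<lambda>x. norm (Z x)"] \<open>a \<le> b\<close> by auto
  have "norm (Z t - Z a) \<le> (\<rho> * norm (Z t)) * (t - a)"
  proof (rule abs_continuous_mean_value[OF ac _ _ E])
    fix x assume x: "x \<in> {a..t} - E"
    then obtain Z' where "(Z has_vector_derivative Z') (at x within {a..b})" "norm Z' \<le> \<rho> * norm (Z x)"
      using der[of x] t by auto
    moreover have "\<rho> * norm (Z x) \<le> \<rho> * norm (Z t)"
      using max[of x] x t \<rho>(1) by (auto intro: mult_left_mono)
    ultimately show "\<exists>Z'. (Z has_vector_derivative Z') (at x within {a..t}) \<and> norm Z' \<le> \<rho> * norm (Z t)"
      using t by (intro exI[of _ Z'] conjI) (auto elim!: has_vector_derivative_within_subset)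
  qed (use t sub in auto)
  also have "\<dots> = (\<rho> * (t - a)) * norm (Z t)" by simp
  also have "\<dots> \<le> (1 / 2) * norm (Z t)"
  proof (rule mult_right_mono)
    show "\<rho> * (t - a) \<le> 1 / 2"
      using \<rho> t by (intro order_trans[OF mult_left_mono \<rho>(2)]) auto
  qed simp
  finally have "norm (Z t) \<le> 2 * norm (Z a)"
    using norm_triangle_ineq2[of "Z t" "Z a"] by linarith
  then show ?thesis using max[of b] \<open>a \<le> b\<close> by force
qed

text \<open>The interval is cut into \<open>m\<close> pieces short enough that the norm at most
  doubles on each. The exponent \<open>1 + 2 * \<rho> * (b - a)\<close> is an upper bound for the
  integer \<open>m\<close>, after 2 is replaced by e.\<close>

lemma abs_continuous_gronwall:
  fixes Z :: "real \<Rightarrow> 'a::real_normed_vector"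
  assumes ac: "abs_continuous_on A B Z" and sub: "{a..b} \<subseteq> {A..B}" and "a \<le> b"
    and E: "negligible E"
    and der: "\<And>x. x \<in> {a..b} - E \<Longrightarrow>
      \<exists>Z'. (Z has_vector_derivative Z') (at x within {a..b}) \<and> norm Z' \<le> \<rho> * norm (Z x)"
    and \<rho>: "0 \<le> \<rho>"
  shows "norm (Z b) \<le> exp (1 + 2 * \<rho> * (b - a)) * norm (Z a)"
proof -
  define m where "m = nat \<lfloor>2 * \<rho> * (b - a)\<rfloor> + 1"
  have m: "2 * \<rho> * (b - a) < real m" "real m \<le> 1 + 2 * \<rho> * (b - a)" "0 < m"
    using \<rho> \<open>a \<le> b\<close> by (simp_all add: m_def) linarith+
  define h where "h = (b - a) / m"
  have h: "0 \<le> h" "\<rho> * h \<le> 1 / 2" "a + real m * h = b"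
    using m \<open>a \<le> b\<close> by (simp_all add: h_def field_simps)
  have "norm (Z (a + real k * h)) \<le> 2 ^ k * norm (Z a)" if "k \<le> m" for k
    using that
  proof (induction k)
    case (Suc k)
    have kh: "real (Suc k) * h \<le> real m * h"
      using Suc.prems h(1) by (intro mult_right_mono) auto
    have "norm (Z (a + real (Suc k) * h)) \<le> 2 * norm (Z (a + real k * h))"
    proof (rule abs_continuous_short_growth[OF ac _ _ E _ \<rho>])
      have incl: "{a + real k * h..a + real (Suc k) * h} \<subseteq> {a..b}"
        using kh h by auto
      then show "{a + real k * h..a + real (Suc k) * h} \<subseteq> {A..B}"
        using sub by blast
      fix x assume "x \<in> {a + real k * h..a + real (Suc k) * h} - E"
      then show "\<exists>Z'. (Z has_vector_derivative Z') (at x within {a + real k * h..a + real (Suc k) * h}) \<and>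
          norm Z' \<le> \<rho> * norm (Z x)"
        using der[of x] incl by (meson Diff_iff has_vector_derivative_within_subset subsetD)
    qed (use h in \<open>auto simp: algebra_simps\<close>)
    then show ?case using Suc by simp
  qed simp
  from this[of m] have "norm (Z b) \<le> 2 ^ m * norm (Z a)" by (simp add: h)
  also have "(2::real) ^ m \<le> exp 1 ^ m"
    using exp_ge_add_one_self[of 1] by (intro power_mono) auto
  also have "\<dots> = exp (real m)" by (simp flip: exp_of_nat_mult)
  also have "\<dots> \<le> exp (1 + 2 * \<rho> * (b - a))" using m by simp
  finally show ?thesis by (simp add: mult_right_mono)
qed

section \<open>Growth over one interval in a rescaled frame\<close>

lemma norm_complex2_square: "(norm (y :: complex^2))\<^sup>2 = (cmod (y $ 1))\<^sup>2 + (cmod (y $ 2))\<^sup>2"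
  by (simp add: norm_vec_def L2_set_def sum_2)

text \<open>Cauchy-Schwarz with real weights: after the triangle inequality the squared sides differ
  by a perfect square (Lagrange identity).\<close>

lemma cauchy_schwarz_cmod:
  "cmod (of_real p * U + of_real q * V) \<le> sqrt (p\<^sup>2 + q\<^sup>2) * norm (U, V)"
proof -
  have "cmod (of_real p * U + of_real q * V) \<le> \<bar>p\<bar> * cmod U + \<bar>q\<bar> * cmod V"
    by (rule order_trans[OF norm_triangle_ineq]) (simp add: norm_mult)
  also have "\<dots> \<le> sqrt ((p\<^sup>2 + q\<^sup>2) * ((cmod U)\<^sup>2 + (cmod V)\<^sup>2))"
  proof (rule real_le_rsqrt)
    have "(p\<^sup>2 + q\<^sup>2) * ((cmod U)\<^sup>2 + (cmod V)\<^sup>2) - (\<bar>p\<bar> * cmod U + \<bar>q\<bar> * cmod V)\<^sup>2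
        = (\<bar>p\<bar> * cmod V - \<bar>q\<bar> * cmod U)\<^sup>2"
      by (simp add: power2_eq_square algebra_simps)
    then show "(\<bar>p\<bar> * cmod U + \<bar>q\<bar> * cmod V)\<^sup>2 \<le> (p\<^sup>2 + q\<^sup>2) * ((cmod U)\<^sup>2 + (cmod V)\<^sup>2)"
      by (metis diff_ge_0_iff_ge zero_le_power2)
  qed
  finally show ?thesis by (simp add: real_sqrt_mult norm_Pair)
qed

text \<open>\<open>V\<close> bounds the sine of the angle between the fixed direction
  \<open>e\<close> and the moving direction \<open>f\<close>. In the weighted frame the coefficient
  keeps rank one: it is \<open>z\<close> times the product of the vectors
  \<open>(s * d, - c / s)\<close> and \<open>(c / s, s * d)\<close> of equal length, so its norm is
  \<open>norm z\<close> times their squared length. The positive \<delta> keeps the weight bounded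
  when \<open>V = 0\<close>; it is later taken to be 1/N.\<close>

lemma weighted_frame_growth:
  fixes Y :: "real \<Rightarrow> complex^2" and z :: complex
  assumes ac: "abs_continuous_on A B Y" and sub: "{a..b} \<subseteq> {A..B}" and "a \<le> b"
    and E: "negligible E"
    and V: "0 \<le> V" and \<delta>: "0 < \<delta>" "\<delta> \<le> 1"
    and e: "e1\<^sup>2 + e2\<^sup>2 = (1::real)"
    and der: "\<And>x. x \<in> {a..b} - E \<Longrightarrow> \<exists>f1 f2 Y'. f1\<^sup>2 + f2\<^sup>2 = (1::real) \<and> \<bar>e1 * f2 - e2 * f1\<bar> \<le> V \<and>
      (Y has_vector_derivative Y') (at x within {a..b}) \<and>
      Y' $ 1 = z * f2 * (f1 * Y x $ 1 + f2 * Y x $ 2) \<and>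
      Y' $ 2 = - z * f1 * (f1 * Y x $ 1 + f2 * Y x $ 2)"
  shows "norm (Y b) \<le> (1 / \<delta>) * exp (1 + 2 * (norm z * (2 * V + \<delta>)) * (b - a)) * norm (Y a)"
proof -
  \<comment> \<open>The weight balances 1/w against w V^2: without \<delta>, the choice 1/V would
    make both equal to \<open>V\<close>. The maximum with 1 gives \<open>1 \<le> s\<close>, so that
    \<open>s\<close> bounds the frame map as well as its inverse.\<close>
  define w where "w = max 1 (1 / (V + \<delta>))"
  define s where "s = sqrt w"
  have w: "1 \<le> w" "1 / w \<le> V + \<delta>" "w \<le> 1 / \<delta>"
  proof -
    show "1 \<le> w" by (simp add: w_def)
    have "1 / (V + \<delta>) \<le> w" by (simp add: w_def)
    then show "1 / w \<le> V + \<delta>"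
      using V \<delta> \<open>1 \<le> w\<close> by (simp add: field_simps)
    show "w \<le> 1 / \<delta>"
      using V \<delta> by (auto simp: w_def intro!: divide_left_mono)
  qed
  have s: "s\<^sup>2 = w" "1 \<le> s" using w(1) by (simp_all add: s_def)
  define T where "T y = (of_real s * (of_real e1 * y $ 1 + of_real e2 * y $ 2),
      (of_real e1 * y $ 2 - of_real e2 * y $ 1) / of_real s)" for y :: "complex^2"
  have T: "bounded_linear T"
  proof -
    have "linear T"
    proof (rule linearI)
      show "T (x + y) = T x + T y" for x y
        by (simp add: T_def algebra_simps add_divide_distrib diff_divide_distrib)
      show "T (c *\<^sub>R x) = c *\<^sub>R T x" for c x
        by (simp add: T_def scaleR_right_diff_distrib) (simp add: scaleR_conv_of_real algebra_simps)
    qed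
    then show ?thesis by (simp add: linear_conv_bounded_linear)
  qed
  have rot: "(cmod (of_real e1 * y + of_real e2 * y'))\<^sup>2 + (cmod (of_real e1 * y' - of_real e2 * y))\<^sup>2
      = (cmod y)\<^sup>2 + (cmod y')\<^sup>2" for y y'
  proof -
    have "(cmod (of_real e1 * y + of_real e2 * y'))\<^sup>2 + (cmod (of_real e1 * y' - of_real e2 * y))\<^sup>2
        = (e1\<^sup>2 + e2\<^sup>2) * ((cmod y)\<^sup>2 + (cmod y')\<^sup>2)"
      unfolding cmod_power2 by (simp add: power2_eq_square algebra_simps)
    then show ?thesis by (simp add: e)
  qed
  have T_sq: "(norm (T y))\<^sup>2 = w * (cmod (of_real e1 * y $ 1 + of_real e2 * y $ 2))\<^sup>2 +
      (cmod (of_real e1 * y $ 2 - of_real e2 * y $ 1))\<^sup>2 / w" for y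
    using s w(1)
    by (auto simp: T_def norm_Pair norm_mult norm_divide power_mult_distrib power_divide
        intro!: add_nonneg_nonneg)
  have up: "t \<le> w * t" if "0 \<le> t" for t
    using mult_right_mono[OF w(1) that] by simp
  have dn: "t / w \<le> w * t" if "0 \<le> t" for t
  proof -
    have "t / w \<le> t / 1" using w(1) that by (intro divide_left_mono) auto
    then show ?thesis using up[OF that] by simp
  qed
  \<comment> \<open>Up to a rotation, \<open>T\<close> stretches one axis by \<open>s\<close> and
    shrinks the other by \<open>1 / s\<close>; since \<open>s\<close> is at least 1, both
    \<open>T\<close> and its inverse have norm at most \<open>s\<close>.\<close>
  have T_le: "norm (T y) \<le> s * norm y" for y
  proof (rule power2_le_imp_le)
    have "(norm (T y))\<^sup>2 \<le> w * (cmod (of_real e1 * y $ 1 + of_real e2 * y $ 2))\<^sup>2 +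
      w * (cmod (of_real e1 * y $ 2 - of_real e2 * y $ 1))\<^sup>2"
      unfolding T_sq by (intro add_left_mono dn) simp
    also have "\<dots> = (s * norm y)\<^sup>2"
      unfolding power_mult_distrib s norm_complex2_square rot[symmetric, of "y $ 1" "y $ 2"]
      by (simp add: algebra_simps)
    finally show "(norm (T y))\<^sup>2 \<le> (s * norm y)\<^sup>2" .
  qed (use s in simp)
  have T_ge: "norm y \<le> s * norm (T y)" for y
  proof (rule power2_le_imp_le)
    have "(norm y)\<^sup>2 = (cmod (of_real e1 * y $ 1 + of_real e2 * y $ 2))\<^sup>2 +
        (cmod (of_real e1 * y $ 2 - of_real e2 * y $ 1))\<^sup>2"
      by (simp add: norm_complex2_square rot)
    also have "\<dots> \<le> w * (w * (cmod (of_real e1 * y $ 1 + of_real e2 * y $ 2))\<^sup>2) +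
        (cmod (of_real e1 * y $ 2 - of_real e2 * y $ 1))\<^sup>2"
      using w(1) by (intro add_right_mono order_trans[OF up up]) auto
    also have "\<dots> = (s * norm (T y))\<^sup>2"
      using w(1) by (simp add: power_mult_distrib s T_sq algebra_simps)
    finally show "(norm y)\<^sup>2 \<le> (s * norm (T y))\<^sup>2" .
  qed (use s in simp)
  have "norm (T (Y b)) \<le> exp (1 + 2 * (norm z * (2 * V + \<delta>)) * (b - a)) * norm (T (Y a))"
  proof (rule abs_continuous_gronwall[OF abs_continuous_on_linear_image[OF ac T] sub \<open>a \<le> b\<close> E])
    show "0 \<le> norm z * (2 * V + \<delta>)" using V \<delta> by simp
    fix x assume "x \<in> {a..b} - E"
    then obtain f1 f2 Y' where f: "f1\<^sup>2 + f2\<^sup>2 = 1" and bV: "\<bar>e1 * f2 - e2 * f1\<bar> \<le> V"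
      and Y': "(Y has_vector_derivative Y') (at x within {a..b})"
      and eq: "Y' $ 1 = z * f2 * (f1 * Y x $ 1 + f2 * Y x $ 2)"
        "Y' $ 2 = - z * f1 * (f1 * Y x $ 1 + f2 * Y x $ 2)"
      using der by blast
    \<comment> \<open>Cosine and sine of the angle from \<open>e\<close> to
      \<open>f\<close>.\<close>
    define c where "c = e1 * f1 + e2 * f2"
    define d where "d = e1 * f2 - e2 * f1"
    define F where "F = of_real f1 * Y x $ 1 + of_real f2 * Y x $ 2"
    have "c\<^sup>2 + d\<^sup>2 = (e1\<^sup>2 + e2\<^sup>2) * (f1\<^sup>2 + f2\<^sup>2)"
      by (simp add: c_def d_def power2_eq_square algebra_simps)
    then have cd: "c\<^sup>2 + d\<^sup>2 = 1" by (simp add: e f)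
    have f_eq: "f1 = c * e1 - d * e2" "f2 = c * e2 + d * e1"
    proof -
      have "c * e1 - d * e2 = f1 * (e1\<^sup>2 + e2\<^sup>2)" "c * e2 + d * e1 = f2 * (e1\<^sup>2 + e2\<^sup>2)"
        by (simp_all add: c_def d_def power2_eq_square algebra_simps)
      then show "f1 = c * e1 - d * e2" "f2 = c * e2 + d * e1" by (simp_all add: e)
    qed
    have TY': "T Y' = (z * (of_real (s * d) * F), z * (of_real (- c / s) * F))"
      unfolding T_def eq F_def[symmetric] by (simp add: c_def d_def algebra_simps divide_simps)
    have "F = of_real (c / s) * fst (T (Y x)) + of_real (s * d) * snd (T (Y x))"
      using s unfolding F_def f_eq T_def by (simp add: algebra_simps divide_simps)
    then have F_le: "cmod F \<le> sqrt ((c / s)\<^sup>2 + (s * d)\<^sup>2) * norm (T (Y x))"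
      using cauchy_schwarz_cmod[of "c / s" "fst (T (Y x))" "s * d" "snd (T (Y x))"] by simp
    have "norm (T Y') = norm z * (sqrt ((c / s)\<^sup>2 + (s * d)\<^sup>2) * cmod F)"
    proof -
      have "(norm (T Y'))\<^sup>2 = (norm z)\<^sup>2 * (((c / s)\<^sup>2 + (s * d)\<^sup>2) * (cmod F)\<^sup>2)"
        by (simp add: TY' norm_Pair norm_mult norm_divide power_mult_distrib power_divide algebra_simps)
      also have "\<dots> = (norm z * (sqrt ((c / s)\<^sup>2 + (s * d)\<^sup>2) * cmod F))\<^sup>2"
        by (simp add: power_mult_distrib)
      finally show ?thesis by (simp add: power2_eq_iff_nonneg)
    qed
    also have "\<dots> \<le> norm z * (sqrt ((c / s)\<^sup>2 + (s * d)\<^sup>2) *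
        (sqrt ((c / s)\<^sup>2 + (s * d)\<^sup>2) * norm (T (Y x))))"
      by (intro mult_left_mono F_le) auto
    also have "\<dots> = norm z * ((c / s)\<^sup>2 + (s * d)\<^sup>2) * norm (T (Y x))"
      by (simp flip: mult.assoc power2_eq_square)
    also have "\<dots> \<le> norm z * (2 * V + \<delta>) * norm (T (Y x))"
    proof (intro mult_right_mono mult_left_mono)
      have "c\<^sup>2 \<le> 1" "d\<^sup>2 \<le> 1"
        using cd zero_le_power2[of c] zero_le_power2[of d] by linarith+
      have "(c / s)\<^sup>2 \<le> 1 / w"
        using \<open>c\<^sup>2 \<le> 1\<close> w(1) unfolding power_divide s by (intro divide_right_mono) auto
      \<comment> \<open>Both values of the maximum in \<open>w\<close> are covered: for
        \<open>w = 1\<close> by d^2 <= |d| <= V, otherwise by d^2 <= V^2 <= V (V +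
        \<delta>).\<close>
      moreover have "w * d\<^sup>2 \<le> V"
      proof -
        have "d\<^sup>2 = \<bar>d\<bar> * \<bar>d\<bar>" by (simp add: power2_eq_square)
        also have "\<bar>d\<bar> \<le> 1" using \<open>d\<^sup>2 \<le> 1\<close> by (simp add: abs_square_le_1)
        then have "\<bar>d\<bar> * \<bar>d\<bar> \<le> V" using bV by (metis d_def abs_ge_zero mult_left_le order_trans)
        finally have "d\<^sup>2 \<le> V" .
        moreover have "d\<^sup>2 \<le> V * (V + \<delta>)"
        proof -
          have "d\<^sup>2 \<le> V * V" using bV by (metis d_def abs_le_square_iff abs_of_nonneg V power2_eq_square)
          also have "\<dots> \<le> V * (V + \<delta>)" using V \<delta> by (intro mult_left_mono) auto
          finally show ?thesis .
        qed
        then have "d\<^sup>2 / (V + \<delta>) \<le> V" using V \<delta> by (simp add: divide_le_eq)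
        ultimately show ?thesis by (auto simp: w_def max_def)
      qed
      ultimately show "(c / s)\<^sup>2 + (s * d)\<^sup>2 \<le> 2 * V + \<delta>"
        using w(2) by (simp add: power_mult_distrib s)
    qed auto
    finally have "norm (T Y') \<le> norm z * (2 * V + \<delta>) * norm (T (Y x))" .
    then show "\<exists>Z'. ((\<lambda>x. T (Y x)) has_vector_derivative Z') (at x within {a..b}) \<and>
        norm Z' \<le> norm z * (2 * V + \<delta>) * norm (T (Y x))"
      using bounded_linear.has_vector_derivative[OF T Y'] by blast
  qed
  \<comment> \<open>Entering and leaving the frame costs a factor \<open>s\<close> each, together
    \<open>w\<close>, which is at most \<open>1 / \<delta>\<close>.\<close>
  then have "norm (Y b) \<le> s * (exp (1 + 2 * (norm z * (2 * V + \<delta>)) * (b - a)) * (s * norm (Y a)))"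
    using s by (intro order_trans[OF T_ge] mult_left_mono order_trans[OF _ mult_left_mono[OF T_le]]) auto
  also have "\<dots> = w * exp (1 + 2 * (norm z * (2 * V + \<delta>)) * (b - a)) * norm (Y a)"
    by (simp add: power2_eq_square flip: s(1))
  also have "\<dots> \<le> (1 / \<delta>) * exp (1 + 2 * (norm z * (2 * V + \<delta>)) * (b - a)) * norm (Y a)"
    using w by (intro mult_right_mono) auto
  finally show ?thesis .
qed

section \<open>Rank one Hamiltonians as projections\<close>

lemma AE_lebesgue_on_negligible:
  assumes "S \<in> sets lebesgue" "AE x in lebesgue_on S. P x"
  obtains E where "negligible E" "\<And>x. x \<in> S - E \<Longrightarrow> P x"
proof -
  have "AE x in lebesgue. x \<in> S \<longrightarrow> P x"
    using assms by (simp add: AE_restrict_space_iff)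
  then obtain E where "E \<in> null_sets lebesgue" "{x \<in> space lebesgue. \<not> (x \<in> S \<longrightarrow> P x)} \<subseteq> E"
    unfolding eventually_ae_filter by blast
  then show ?thesis
    by (intro that[of E]) (auto simp: negligible_iff_null_sets)
qed

text \<open>The orthogonal projection onto the line spanned by a unit vector, which is determined up
  to sign.\<close>

definition outer_square :: "real^2^2 \<Rightarrow> real \<Rightarrow> real \<Rightarrow> bool" where
  "outer_square A f1 f2 \<longleftrightarrow> f1\<^sup>2 + f2\<^sup>2 = 1 \<and>
    A $ 1 $ 1 = f1\<^sup>2 \<and> A $ 1 $ 2 = f1 * f2 \<and> A $ 2 $ 1 = f1 * f2 \<and> A $ 2 $ 2 = f2\<^sup>2"

text \<open>The determinant vanishes, so the diagonal entries have sum 1 and product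
  \<open>(A $ 1 $ 2)\<^sup>2\<close>, and both are nonnegative. Their square roots give the vector,
  with the sign of the off-diagonal entry put into \<open>f2\<close>.\<close>

lemma rank_one_outer_square:
  fixes A :: "real^2^2"
  assumes sym: "transpose A = A" and tr: "trace A = 1" and rk: "rank A = 1"
  obtains f1 f2 where "outer_square A f1 f2"
proof -
  have A21: "A $ 2 $ 1 = A $ 1 $ 2"
    using arg_cong[OF sym, of "\<lambda>B. B $ 1 $ 2"] by (simp add: transpose_def)
  have "det A = 0" using rk by (simp add: det_eq_0_rank)
  then have det: "A $ 1 $ 1 * A $ 2 $ 2 = (A $ 1 $ 2)\<^sup>2"
    by (simp add: det_2 A21 power2_eq_square)
  have tr': "A $ 1 $ 1 + A $ 2 $ 2 = 1" using tr by (simp add: trace_def sum_2)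
  have nn: "0 \<le> A $ 1 $ 1" "0 \<le> A $ 2 $ 2"
    using tr' det zero_le_power2[of "A $ 1 $ 2"] by (smt (verit) zero_le_mult_iff)+
  define f2 where "f2 = (if A $ 1 $ 2 \<ge> 0 then sqrt (A $ 2 $ 2) else - sqrt (A $ 2 $ 2))"
  have "sqrt (A $ 1 $ 1) * sqrt (A $ 2 $ 2) = \<bar>A $ 1 $ 2\<bar>"
    by (simp add: det flip: real_sqrt_mult)
  then have "outer_square A (sqrt (A $ 1 $ 1)) f2"
    using nn tr' by (auto simp: outer_square_def f2_def A21)
  then show ?thesis by (rule that)
qed

text \<open>The left side is the sine of the angle between the two lines. The Frobenius norm of the
  difference of the two projections is sqrt 2 times this sine.\<close>

lemma outer_square_angle:
  assumes "outer_square A e1 e2" "outer_square B f1 f2"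
  shows "\<bar>e1 * f2 - e2 * f1\<bar> \<le> norm (A - B)"
proof (rule power2_le_imp_le)
  have e: "e1\<^sup>2 + e2\<^sup>2 = 1" and f: "f1\<^sup>2 + f2\<^sup>2 = 1"
    using assms by (simp_all add: outer_square_def)
  have "(norm (A - B))\<^sup>2 = (e1\<^sup>2 - f1\<^sup>2)\<^sup>2 + 2 * (e1 * e2 - f1 * f2)\<^sup>2 + (e2\<^sup>2 - f2\<^sup>2)\<^sup>2"
    using assms by (simp add: power2_norm_eq_inner inner_vec_def sum_2 outer_square_def)
      (simp add: power2_eq_square)
  also have "\<dots> = (e1\<^sup>2 + e2\<^sup>2)\<^sup>2 + (f1\<^sup>2 + f2\<^sup>2)\<^sup>2 - 2 * (e1 * f1 + e2 * f2)\<^sup>2"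
    by algebra
  also have "\<dots> = 2 * ((e1\<^sup>2 + e2\<^sup>2) * (f1\<^sup>2 + f2\<^sup>2)) - 2 * (e1 * f1 + e2 * f2)\<^sup>2"
    by (simp add: e f)
  also have "\<dots> = 2 * (e1 * f2 - e2 * f1)\<^sup>2" by algebra
  finally show "\<bar>e1 * f2 - e2 * f1\<bar>\<^sup>2 \<le> (norm (A - B))\<^sup>2" by simp
qed simp

lemma rank_one_hamiltonian:
  assumes "hamiltonian H L" "AE x in lebesgue_on {0..L}. rank (H x) = 1"
  obtains E where "negligible E" "\<And>x. x \<in> {0..L} - E \<Longrightarrow> \<exists>f1 f2. outer_square (H x) f1 f2"
proof -
  have "AE x in lebesgue_on {0..L}. trace (H x) = 1 \<and> rank (H x) = 1"
    using assms unfolding hamiltonian_def by auto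
  then obtain E where "negligible E" "\<And>x. x \<in> {0..L} - E \<Longrightarrow> trace (H x) = 1 \<and> rank (H x) = 1"
    by (rule AE_lebesgue_on_negligible[rotated]) auto
  moreover have "transpose (H x) = H x" if "x \<in> {0..L}" for x
    using assms(1) that by (simp add: hamiltonian_def)
  ultimately show ?thesis
    by (intro that[of E]) (metis Diff_iff rank_one_outer_square)+
qed

text \<open>For H = f f^T the system reads Y' = - z J f (f . Y), because J squared is minus the
  identity.\<close>

lemma canonical_system_components:
  assumes "J *v Y' = z *s (cmatrix A *v y)" "outer_square A f1 f2"
  shows "Y' $ 1 = z * f2 * (f1 * y $ 1 + f2 * y $ 2)"
    and "Y' $ 2 = - z * f1 * (f1 * y $ 1 + f2 * y $ 2)"
proof -
  have "(J *v Y') $ 1 = z * (cmatrix A *v y) $ 1" "(J *v Y') $ 2 = z * (cmatrix A *v y) $ 2"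
    using assms(1) by simp_all
  then have "- Y' $ 2 = z * (f1\<^sup>2 * y $ 1 + (f1 * f2) * y $ 2)"
    "Y' $ 1 = z * ((f1 * f2) * y $ 1 + f2\<^sup>2 * y $ 2)"
    using assms(2)
    by (simp_all add: matrix_vector_mult_def J_def cmatrix_def vector_2 sum_2 outer_square_def)
  then show "Y' $ 1 = z * f2 * (f1 * y $ 1 + f2 * y $ 2)"
    "Y' $ 2 = - z * f1 * (f1 * y $ 1 + f2 * y $ 2)"
    by (simp_all add: power2_eq_square algebra_simps minus_equation_iff[of "Y' $ 2"])
qed

section \<open>Growth of a solution over the whole interval\<close>

text \<open>The one-interval estimate with \<delta> = 1/N is multiplied over the \<open>N\<close>
  pieces. Each piece contributes a factor \<open>N\<close> from the change of frame and the constant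
  1 of the Gronwall exponent, whence \<open>N * (1 + ln N)\<close>; the \<open>N\<close> values of
  \<delta> add up to 1.\<close>

lemma canonical_solution_growth:
  fixes N :: nat and V :: "nat \<Rightarrow> real"
  assumes "L > 0" and ham: "hamiltonian H L" and rk: "AE x in lebesgue_on {0..L}. rank (H x) = 1"
    and sol: "canonical_solution H L z Y" and "N > 0" and V0: "\<And>k. k < N \<Longrightarrow> 0 \<le> V k"
    and osc: "\<And>k x y. k < N \<Longrightarrow> x \<in> {k * (L / N)..Suc k * (L / N)} \<Longrightarrow>
      y \<in> {k * (L / N)..Suc k * (L / N)} \<Longrightarrow> norm (H x - H y) \<le> V k"
  shows "norm (Y L) \<le> exp (N * (1 + ln N) + 2 * norm z * (L / N) * (2 * (\<Sum>k<N. V k) + 1)) * norm (Y 0)"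
proof -
  define h where "h = L / N"
  have h: "0 < h" "real N * h = L" using \<open>L > 0\<close> \<open>N > 0\<close> by (simp_all add: h_def)
  obtain E1 where E1: "negligible E1" "\<And>x. x \<in> {0..L} - E1 \<Longrightarrow> \<exists>f1 f2. outer_square (H x) f1 f2"
    using rank_one_hamiltonian[OF ham rk] by blast
  obtain E2 where E2: "negligible E2" "\<And>x. x \<in> {0..L} - E2 \<Longrightarrow> \<exists>Y'.
      (Y has_vector_derivative Y') (at x within {0..L}) \<and> J *v Y' = z *s (cmatrix (H x) *v Y x)"
    using sol unfolding canonical_solution_def
    by (elim conjE AE_lebesgue_on_negligible[rotated]) auto
  define E where "E = E1 \<union> E2"
  have E: "negligible E" using E1 E2 by (simp add: E_def)
  have step: "norm (Y (Suc k * h)) \<le> (1 / (1 / N)) *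
      exp (1 + 2 * (norm z * (2 * V k + 1 / N)) * (Suc k * h - k * h)) * norm (Y (k * h))"
    if k: "k < N" for k
  proof -
    have "real (Suc k) * h \<le> real N * h"
      using k h(1) by (intro mult_right_mono) auto
    then have sub: "{k * h..Suc k * h} \<subseteq> {0..L}" using h by auto
    have lt: "real k * h < real (Suc k) * h" using h(1) by simp
    \<comment> \<open>The point \<open>x0\<close> that fixes the frame has to avoid
      \<open>E\<close>, because \<open>H\<close> is known to be a projection only off it; a piece of
      positive length is not negligible.\<close>
    then have "\<not> {k * h..Suc k * h} \<subseteq> E"
      using negligible_subset[OF E, of "cbox (k * h) (Suc k * h)"]
      unfolding negligible_interval by auto
    then obtain x0 where x0: "x0 \<in> {k * h..Suc k * h}" "x0 \<notin> E" by blast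
    then obtain e1 e2 where e: "outer_square (H x0) e1 e2"
      using E1(2)[of x0] sub by (auto simp: E_def)
    show ?thesis
    proof (rule weighted_frame_growth[OF _ sub _ E V0[OF k]])
      show "abs_continuous_on 0 L Y" using sol by (simp add: canonical_solution_def)
      show "e1\<^sup>2 + e2\<^sup>2 = 1" using e by (simp add: outer_square_def)
      fix x assume x: "x \<in> {k * h..Suc k * h} - E"
      then have xE: "x \<in> {0..L} - E1" "x \<in> {0..L} - E2" using sub by (auto simp: E_def)
      obtain f1 f2 where f: "outer_square (H x) f1 f2" using E1(2)[OF xE(1)] by blast
      obtain Y' where Y': "(Y has_vector_derivative Y') (at x within {0..L})"
        "J *v Y' = z *s (cmatrix (H x) *v Y x)" using E2(2)[OF xE(2)] by blast
      have "\<bar>e1 * f2 - e2 * f1\<bar> \<le> V k"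
        using outer_square_angle[OF e f] osc[OF k, of x0 x] x x0 unfolding h_def by auto
      then show "\<exists>f1 f2 Y'. f1\<^sup>2 + f2\<^sup>2 = 1 \<and> \<bar>e1 * f2 - e2 * f1\<bar> \<le> V k \<and>
        (Y has_vector_derivative Y') (at x within {k * h..Suc k * h}) \<and>
        Y' $ 1 = z * f2 * (f1 * Y x $ 1 + f2 * Y x $ 2) \<and>
        Y' $ 2 = - z * f1 * (f1 * Y x $ 1 + f2 * Y x $ 2)"
        using f canonical_system_components[OF Y'(2) f]
          has_vector_derivative_within_subset[OF Y'(1) sub]
        by (intro exI[of _ f1] exI[of _ f2] exI[of _ Y']) (auto simp: outer_square_def)
    qed (use lt \<open>N > 0\<close> in auto)
  qed
  have "norm (Y (k * h)) \<le> exp (k * (1 + ln N) + 2 * norm z * h * (2 * (\<Sum>i<k. V i) + k / N)) * norm (Y 0)"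
    if "k \<le> N" for k
    using that
  proof (induction k)
    case (Suc k)
    have "norm (Y (Suc k * h)) \<le> exp (1 + ln N + 2 * norm z * h * (2 * V k + 1 / N)) * norm (Y (k * h))"
      using step[of k] Suc.prems \<open>N > 0\<close> by (simp add: exp_add algebra_simps)
    also have "\<dots> \<le> exp (1 + ln N + 2 * norm z * h * (2 * V k + 1 / N)) *
        (exp (k * (1 + ln N) + 2 * norm z * h * (2 * (\<Sum>i<k. V i) + k / N)) * norm (Y 0))"
      using Suc by (intro mult_left_mono) auto
    also have "\<dots> = exp (Suc k * (1 + ln N) + 2 * norm z * h * (2 * (\<Sum>i<Suc k. V i) + Suc k / N)) * norm (Y 0)"
      unfolding mult.assoc[symmetric] exp_add[symmetric]
      by (simp add: algebra_simps add_divide_distrib)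
    finally show ?case .
  qed simp
  from this[of N] show ?thesis using h \<open>N > 0\<close> by (simp add: h_def)
qed

section \<open>From a growth bound to the order\<close>

text \<open>The second logarithm turns \<open>K\<close> and the logarithmic factor into additive
  terms, which vanish in the limit after division by \<open>ln (norm z)\<close>.\<close>

lemma growth_order_le:
  fixes g :: "complex \<Rightarrow> real"
  assumes "0 < K" "0 \<le> \<gamma>"
    and g: "\<And>z. 1 \<le> norm z \<Longrightarrow> g z \<le> exp (K * norm z powr \<gamma> * (1 + ln (norm z)))"
  shows "growth_order g \<le> ereal \<gamma>"
proof -
  define G where "G r = ln (K + 1) / ln r + \<gamma> + ln (1 + ln r) / ln r" for r
  have "(G \<longlongrightarrow> 0 + \<gamma> + 0) at_top"
    unfolding G_def by (intro tendsto_add tendsto_const) real_asymp+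
  then have "((\<lambda>z. G (norm z)) \<longlongrightarrow> \<gamma>) (at_infinity :: complex filter)"
    using filterlim_compose[OF _ filterlim_norm_at_top] by fastforce
  then have lim: "Limsup at_infinity (\<lambda>z::complex. ereal (G (norm z))) = ereal \<gamma>"
    by (intro lim_imp_Limsup) (auto simp: trivial_limit_at_infinity)
  have "\<forall>\<^sub>F z in at_infinity. ereal (ln_plus (ln_plus (g z)) / ln (norm z)) \<le> ereal (G (norm z))"
    unfolding eventually_at_infinity
  proof (intro exI[of _ 2] allI impI)
    fix z :: complex assume "2 \<le> norm z"
    define r where "r = norm z"
    have r: "2 \<le> r" "0 < ln r" using \<open>2 \<le> norm z\<close> by (auto simp: r_def intro!: ln_gt_zero)
    define t where "t = r powr \<gamma> * (1 + ln r)"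
    have "1 \<le> r powr \<gamma>" using r \<open>0 \<le> \<gamma>\<close> by (intro ge_one_powr_ge_zero) auto
    then have t: "1 \<le> t" using r mult_mono[of 1 "r powr \<gamma>" 1 "1 + ln r"] by (simp add: t_def)
    have "g z \<le> exp (K * t)" using g[of z] r by (simp add: r_def t_def mult.assoc)
    then have "max 1 (g z) \<le> exp (K * t)" using \<open>0 < K\<close> t by simp
    then have "ln_plus (g z) \<le> K * t"
      using ln_le_cancel_iff[of "max 1 (g z)" "exp (K * t)"] by (simp add: ln_plus_def)
    \<comment> \<open>With \<open>K + 1\<close> in place of \<open>K\<close> the bound is at least
      1, as the truncation in the outer \<open>ln_plus\<close> requires.\<close>
    also have "\<dots> \<le> (K + 1) * t" using t by (simp add: distrib_right)
    finally have "max 1 (ln_plus (g z)) \<le> (K + 1) * t"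
      using t \<open>0 < K\<close> mult_mono[of 1 "K + 1" 1 t] by auto
    then have "ln_plus (ln_plus (g z)) \<le> ln ((K + 1) * t)"
      unfolding ln_plus_def[of "ln_plus (g z)"] using t \<open>0 < K\<close> by (subst ln_le_cancel_iff) auto
    also have "\<dots> = ln (K + 1) + \<gamma> * ln r + ln (1 + ln r)"
    proof -
      have "ln t = \<gamma> * ln r + ln (1 + ln r)"
        unfolding t_def using r add_pos_pos[OF zero_less_one r(2)] by (simp add: ln_mult_pos ln_powr)
      then show ?thesis using t \<open>0 < K\<close> by (simp add: ln_mult_pos)
    qed
    finally have "ln_plus (ln_plus (g z)) / ln r \<le> (ln (K + 1) + \<gamma> * ln r + ln (1 + ln r)) / ln r"
      using r by (intro divide_right_mono) auto
    also have "\<dots> = G r" using r by (simp add: G_def add_divide_distrib)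
    finally show "ereal (ln_plus (ln_plus (g z)) / ln (norm z)) \<le> ereal (G (norm z))"
      by (simp add: r_def)
  qed
  then show ?thesis
    unfolding growth_order_def lim[symmetric] by (rule Limsup_mono)
qed

section \<open>Oscillation on equal pieces: Hoelder continuity and bounded variation\<close>

text \<open>
  The scale \<open>C * N powr (1 - \<beta>)\<close> is what a Hoelder exponent \<open>\<beta>\<close> gives on
  \<open>N\<close> equal intervals; bounded variation corresponds to \<open>\<beta> = 1\<close>.
\<close>
definition oscillation_bound :: "(real \<Rightarrow> 'a::real_normed_vector) \<Rightarrow> real \<Rightarrow> real \<Rightarrow> real \<Rightarrow> bool" where
  "oscillation_bound H L \<beta> C \<longleftrightarrow> (\<forall>N::nat. N > 0 \<longrightarrow> (\<exists>V. (\<forall>k<N. 0 \<le> V k \<and>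
      (\<forall>x\<in>{k * (L / N)..Suc k * (L / N)}. \<forall>y\<in>{k * (L / N)..Suc k * (L / N)}. norm (H x - H y) \<le> V k)) \<and>
    (\<Sum>k<N. V k) \<le> C * N powr (1 - \<beta>)))"

lemma subinterval_subset:
  fixes L :: real
  assumes "0 \<le> L" "k < N"
  shows "{k * (L / real N)..Suc k * (L / N)} \<subseteq> {0..L}"
proof -
  have "real (Suc k) * (L / N) \<le> real N * (L / N)"
    using assms by (intro mult_right_mono) auto
  moreover have "real N * (L / N) = L" using assms by simp
  ultimately show ?thesis using assms by auto
qed

text \<open>All \<open>N\<close> pieces share the bound C (L/N)^\<alpha>; summing them leaves N^(1 -
  \<alpha>).\<close>

lemma hoelder_oscillation_bound:
  assumes "L > 0" "0 < \<alpha>" "hoelder_on \<alpha> {0..L} H"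
  shows "\<exists>C\<ge>0. oscillation_bound H L \<alpha> C"
proof -
  obtain C0 where C0: "\<And>x y. x \<in> {0..L} \<Longrightarrow> y \<in> {0..L} \<Longrightarrow> norm (H x - H y) \<le> C0 * \<bar>x - y\<bar> powr \<alpha>"
    using assms(3) unfolding hoelder_on_def by blast
  \<comment> \<open>The constant \<open>C0\<close> comes without a sign; its positive part is still
    a Hoelder constant.\<close>
  define C where "C = max 0 C0"
  have "oscillation_bound H L \<alpha> (C * L powr \<alpha>)"
    unfolding oscillation_bound_def
  proof (intro allI impI)
    fix N :: nat assume "N > 0"
    show "\<exists>V. (\<forall>k<N. 0 \<le> V k \<and> (\<forall>x\<in>{k * (L / N)..Suc k * (L / N)}.
        \<forall>y\<in>{k * (L / N)..Suc k * (L / N)}. norm (H x - H y) \<le> V k)) \<and>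
      (\<Sum>k<N. V k) \<le> C * L powr \<alpha> * N powr (1 - \<alpha>)"
    proof (intro exI[of _ "\<lambda>_. C * (L / N) powr \<alpha>"] conjI allI impI ballI)
      fix k x y assume k: "k < N" and x: "x \<in> {k * (L / N)..Suc k * (L / N)}"
        and y: "y \<in> {k * (L / N)..Suc k * (L / N)}"
      have xy: "x \<in> {0..L}" "y \<in> {0..L}" using subinterval_subset[of L k N, THEN subsetD] x y k \<open>L > 0\<close> by force+
      have "real (Suc k) * (L / N) = k * (L / N) + L / N" by (simp add: algebra_simps add_divide_distrib)
      then have "\<bar>x - y\<bar> \<le> L / N" using x y unfolding atLeastAtMost_iff by linarith
      then have "\<bar>x - y\<bar> powr \<alpha> \<le> (L / N) powr \<alpha>" using \<open>0 < \<alpha>\<close> by (intro powr_mono2) auto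
      then have "C * \<bar>x - y\<bar> powr \<alpha> \<le> C * (L / N) powr \<alpha>"
        by (intro mult_left_mono) (auto simp: C_def)
      moreover have "C0 * \<bar>x - y\<bar> powr \<alpha> \<le> C * \<bar>x - y\<bar> powr \<alpha>"
        by (intro mult_right_mono) (auto simp: C_def)
      ultimately show "norm (H x - H y) \<le> C * (L / N) powr \<alpha>" using C0[OF xy] by linarith
    next
      show "(\<Sum>k<N. C * (L / N) powr \<alpha>) \<le> C * L powr \<alpha> * N powr (1 - \<alpha>)"
        using \<open>N > 0\<close> \<open>L > 0\<close> by (simp add: powr_divide powr_diff mult_ac)
    qed (simp add: C_def)
  qed
  then show ?thesis by (intro exI[of _ "C * L powr \<alpha>"]) (simp add: C_def)
qed

text \<open>Intervals in successive cells of the grid \<open>t\<close> do not overlap, so they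
  extend to a division of all of \<open>{0..L}\<close>, the kind of division that \<open>B\<close>
  controls. The added members only increase the sum.\<close>

lemma bounded_variation_partial_sum:
  fixes H :: "real \<Rightarrow> 'a::real_normed_vector"
  assumes B: "\<And>d. d division_of {0..L} \<Longrightarrow> (\<Sum>k\<in>d. norm (H (Sup k) - H (Inf k))) \<le> B"
    and uv: "\<And>k. k < N \<Longrightarrow> t k \<le> u k \<and> u k \<le> v k \<and> v k \<le> t (Suc k)"
    and t: "mono t" "0 \<le> t 0" "t N \<le> L"
  shows "(\<Sum>k<N. norm (H (v k) - H (u k))) \<le> B"
proof -
  define p where "p = (\<lambda>k. {u k..v k}) ` {..<N}"
  have disj: "interior {u i..v i} \<inter> interior {u j..v j} = {}" if "i < j" "j < N" for i j
  proof -
    have "v i \<le> t (Suc i)" "t (Suc i) \<le> t j" "t j \<le> u j"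
      using uv[of i] uv[of j] that t(1) by (auto intro: monoD)
    then show ?thesis by (auto simp: interior_atLeastAtMost_real)
  qed
  have disj': "interior {u i..v i} \<inter> interior {u j..v j} = {}" if "i \<noteq> j" "i < N" "j < N" for i j
    using disj[of i j] disj[of j i] that by (cases "i < j") (auto simp: Int_commute)
  have sub: "{u k..v k} \<subseteq> {0..L}" if "k < N" for k
  proof -
    have "t 0 \<le> t k" "t (Suc k) \<le> t N" using t(1) that by (auto intro: monoD)
    then show ?thesis using uv[OF that] t by auto
  qed
  have "p division_of \<Union>p"
  proof (rule division_ofI)
    fix K assume "K \<in> p"
    then obtain k where "k < N" "K = {u k..v k}" by (auto simp: p_def)
    then show "K \<noteq> {}" "\<exists>a b. K = cbox a b" using uv[of k] by auto
  next
    fix K1 K2 assume "K1 \<in> p" "K2 \<in> p" "K1 \<noteq> K2"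
    then obtain i j where "i < N" "j < N" "K1 = {u i..v i}" "K2 = {u j..v j}" "i \<noteq> j"
      by (auto simp: p_def)
    then show "interior K1 \<inter> interior K2 = {}" using disj' by simp
  qed (auto simp: p_def)
  moreover have "\<Union>p \<subseteq> cbox 0 L" using sub by (fastforce simp: p_def)
  ultimately obtain q where q: "p \<subseteq> q" "q division_of cbox 0 L"
    using partial_division_extend_interval by metis
  have "(\<Sum>k<N. norm (H (v k) - H (u k))) = (\<Sum>k<N. norm (H (Sup {u k..v k}) - H (Inf {u k..v k})))"
    using uv by (intro sum.cong) auto
  also have "\<dots> = (\<Sum>K\<in>p. norm (H (Sup K) - H (Inf K)))"
    unfolding p_def
  proof (subst sum.reindex_nontrivial)
    \<comment> \<open>Distinct indices give the same interval only if it is degenerate, and then it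
      contributes 0.\<close>
    fix i j assume ij: "i \<in> {..<N}" "j \<in> {..<N}" "i \<noteq> j" "{u i..v i} = {u j..v j}"
    then have "interior {u i..v i} = {}" using disj'[of i j] by auto
    then have "u i = v i" using uv[of i] ij by (auto simp: interior_atLeastAtMost_real)
    then show "norm (H (Sup {u i..v i}) - H (Inf {u i..v i})) = 0" by simp
  qed auto
  also have "\<dots> \<le> (\<Sum>K\<in>q. norm (H (Sup K) - H (Inf K)))"
    using q by (intro sum_mono2) auto
  also have "\<dots> \<le> B" using B[of q] q(2) by simp
  finally show ?thesis .
qed

text \<open>\<open>V k\<close> is the supremum of the increments on the k-th piece, which need not
  be attained. Pairs within 1/N of the suprema have increments summing to at most \<open>B\<close>,
  and the \<open>N\<close> errors add up to 1, whence the constant \<open>B + 1\<close>.\<close>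

lemma bounded_variation_oscillation_bound:
  fixes H :: "real \<Rightarrow> 'a::real_normed_vector"
  assumes "L > 0" "bounded_variation_on 0 L H"
  shows "\<exists>C\<ge>0. oscillation_bound H L 1 C"
proof -
  obtain B where B: "\<And>d. d division_of {0..L} \<Longrightarrow> (\<Sum>k\<in>d. norm (H (Sup k) - H (Inf k))) \<le> B"
    using assms(2) unfolding bounded_variation_on_def by blast
  \<comment> \<open>The case of one increment makes the suprema below finite.\<close>
  have two: "norm (H x - H y) \<le> B" if "x \<in> {0..L}" "y \<in> {0..L}" "x \<le> y" for x y
  proof -
    have "(\<Sum>k<(1::nat). norm (H y - H x)) \<le> B"
      by (rule bounded_variation_partial_sum[where H = H and L = L and N = 1 and u = "\<lambda>_. x" and v = "\<lambda>_. y"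
            and t = "\<lambda>k. if k = 0 then x else y"])
        (use B that in \<open>auto simp: mono_def\<close>)
    then show ?thesis by (simp add: norm_minus_commute)
  qed
  have "0 \<le> B" using two[of 0 0] \<open>L > 0\<close> by simp
  have "oscillation_bound H L 1 (B + 1)"
    unfolding oscillation_bound_def
  proof (intro allI impI)
    fix N :: nat assume "N > 0"
    define t where "t k = real k * (L / N)" for k
    \<comment> \<open>The pairs are ordered so that each spans an interval usable in a division;
      symmetry of the norm covers the other order.\<close>
    define W where "W k = {norm (H y - H x) | x y. t k \<le> x \<and> x \<le> y \<and> y \<le> t (Suc k)}" for k
    have t: "mono t" "t 0 = 0" "t N = L"
      using \<open>L > 0\<close> \<open>N > 0\<close> by (auto simp: mono_def t_def intro!: divide_right_mono mult_right_mono)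
    have sub: "{t k..t (Suc k)} \<subseteq> {0..L}" if "k < N" for k
      using subinterval_subset[of L k N] that \<open>L > 0\<close> by (simp add: t_def)
    have Wb: "bdd_above (W k)" if "k < N" for k
      unfolding W_def using two sub[OF that]
      by (intro bdd_aboveI[of _ B]) (force simp: norm_minus_commute)
    have W0: "0 \<in> W k" for k
      using t(1) by (auto simp: W_def mono_def intro!: exI[of _ "t k"])
    have "\<exists>x y. t k \<le> x \<and> x \<le> y \<and> y \<le> t (Suc k) \<and> Sup (W k) - 1 / N < norm (H y - H x)" if k: "k < N" for k
    proof -
      have "Sup (W k) - 1 / N < Sup (W k)" using \<open>N > 0\<close> by simp
      then obtain w where "w \<in> W k" "Sup (W k) - 1 / N < w"
        using less_cSup_iff[of "W k"] W0 Wb[OF k] by blast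
      then show ?thesis by (auto simp: W_def)
    qed
    then obtain x y where xy: "\<And>k. k < N \<Longrightarrow> t k \<le> x k \<and> x k \<le> y k \<and> y k \<le> t (Suc k) \<and>
        Sup (W k) - 1 / N < norm (H (y k) - H (x k))"
      by metis
    have "(\<Sum>k<N. Sup (W k)) \<le> (\<Sum>k<N. norm (H (y k) - H (x k)) + 1 / N)"
      using xy by (intro sum_mono) force
    also have "\<dots> \<le> B + 1"
      using bounded_variation_partial_sum[of L H B N t x y] B xy t \<open>N > 0\<close>
      by (simp add: sum.distrib)
    finally have sum: "(\<Sum>k<N. Sup (W k)) \<le> (B + 1) * N powr (1 - 1)" using \<open>N > 0\<close> by simp
    have "norm (H a - H b) \<le> Sup (W k)" if "k < N" "a \<in> {t k..t (Suc k)}" "b \<in> {t k..t (Suc k)}" for k a b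
    proof (rule cSup_upper[OF _ Wb[OF that(1)]])
      show "norm (H a - H b) \<in> W k"
        using that(2,3) unfolding W_def by (cases "a \<le> b") (force simp: norm_minus_commute)+
    qed
    then show "\<exists>V. (\<forall>k<N. 0 \<le> V k \<and> (\<forall>x\<in>{k * (L / N)..Suc k * (L / N)}.
        \<forall>y\<in>{k * (L / N)..Suc k * (L / N)}. norm (H x - H y) \<le> V k)) \<and>
      (\<Sum>k<N. V k) \<le> (B + 1) * N powr (1 - 1)"
      using sum cSup_upper[OF W0 Wb] unfolding t_def
      by (intro exI[of _ "\<lambda>k. Sup (W k)"]) auto
  qed
  then show ?thesis using \<open>0 \<le> B\<close> by (intro exI[of _ "B + 1"]) auto
qed

section \<open>Choice of the number of pieces and the resulting order\<close>

text \<open>With r = norm z, the exponent consists of a frame part of size N (1 + log N) and an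
  oscillation part of size r N^(-\<beta>). Up to the logarithm they balance at N ~ r^\<gamma>,
  because 1 - \<gamma> \<beta> = \<gamma>. \<open>K\<close> is uniform in the solution, so it serves
  every column of the monodromy matrix.\<close>

lemma oscillation_bound_growth:
  assumes "L > 0" and ham: "hamiltonian H L" and rk: "AE x in lebesgue_on {0..L}. rank (H x) = 1"
    and \<beta>: "0 < \<beta>" "\<beta> \<le> 1" and "0 \<le> C" and osc: "oscillation_bound H L \<beta> C"
  obtains K where "0 < K" "\<And>z Y. canonical_solution H L z Y \<Longrightarrow> 1 \<le> norm z \<Longrightarrow>
    norm (Y L) \<le> exp (K * norm z powr (1 / (1 + \<beta>)) * (1 + ln (norm z))) * norm (Y 0)"
proof -
  define \<gamma> where "\<gamma> = 1 / (1 + \<beta>)"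
  have \<gamma>: "0 < \<gamma>" "\<gamma> \<le> 1" "1 - \<gamma> * \<beta> = \<gamma>" using \<beta> by (auto simp: \<gamma>_def field_simps)
  \<comment> \<open>The 4 is the product of the factors 2 in N <= 2 r^\<gamma> and 1 + ln N <= 2 (1
    + ln r); the other term bounds the oscillation part.\<close>
  define K where "K = 4 + 2 * L * (2 * C + 1)"
  have "norm (Y L) \<le> exp (K * norm z powr \<gamma> * (1 + ln (norm z))) * norm (Y 0)"
    if sol: "canonical_solution H L z Y" and z: "1 \<le> norm z" for z Y
  proof -
    define r where "r = norm z"
    define N where "N = nat \<lceil>r powr \<gamma>\<rceil>"
    have r: "1 \<le> r" "0 \<le> ln r" using z by (auto simp: r_def)
    have r1: "1 \<le> r powr \<gamma>" using r \<gamma> by (intro ge_one_powr_ge_zero) auto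
    have N: "r powr \<gamma> \<le> N" "N \<le> 2 * r powr \<gamma>" "N > 0"
      using r1 unfolding N_def by linarith+
    have "ln N \<le> ln (2 * r powr \<gamma>)" using N by (subst ln_le_cancel_iff) auto
    also have "\<dots> = ln 2 + \<gamma> * ln r" using r by (simp add: ln_mult ln_powr)
    also have "\<dots> \<le> 1 + ln r"
      using ln_le_minus_one[of 2] mult_right_mono[OF \<gamma>(2) r(2)] by simp
    finally have lnN: "1 + ln N \<le> 2 * (1 + ln r)" using r(2) by (simp add: distrib_left)
    have N1: "N * (1 + ln N) \<le> (2 * r powr \<gamma>) * (2 * (1 + ln r))"
      using N lnN by (intro mult_mono) auto
    obtain V where V: "\<And>k. k < N \<Longrightarrow> 0 \<le> V k"
      "\<And>k x y. k < N \<Longrightarrow> x \<in> {k * (L / N)..Suc k * (L / N)} \<Longrightarrow>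
        y \<in> {k * (L / N)..Suc k * (L / N)} \<Longrightarrow> norm (H x - H y) \<le> V k"
      "(\<Sum>k<N. V k) \<le> C * N powr (1 - \<beta>)"
      using osc \<open>N > 0\<close> unfolding oscillation_bound_def by meson
    \<comment> \<open>This absorbs the extra 1 in the exponent into the oscillation scale.\<close>
    have "1 \<le> N powr (1 - \<beta>)" using N(3) \<beta> by (intro ge_one_powr_ge_zero) auto
    then have "2 * (\<Sum>k<N. V k) + 1 \<le> (2 * C + 1) * N powr (1 - \<beta>)"
      using V(3) by (simp add: algebra_simps)
    then have "2 * r * (L / N) * (2 * (\<Sum>k<N. V k) + 1) \<le> 2 * r * (L / N) * ((2 * C + 1) * N powr (1 - \<beta>))"
      using r \<open>L > 0\<close> by (intro mult_left_mono) auto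
    also have "\<dots> = 2 * L * (2 * C + 1) * (r * N powr (- \<beta>))"
      using N(3) by (simp add: powr_diff powr_minus field_simps)
    \<comment> \<open>The exponent is negative, so it is the lower bound r^\<gamma> <= N that enters
      here.\<close>
    also have "\<dots> \<le> 2 * L * (2 * C + 1) * (r * (r powr \<gamma>) powr (- \<beta>))"
      using N r1 r \<beta> \<open>L > 0\<close> \<open>0 \<le> C\<close> by (intro mult_left_mono powr_mono2') auto
    also have "r * (r powr \<gamma>) powr (- \<beta>) = r powr (1 - \<gamma> * \<beta>)"
      using r by (simp add: powr_powr powr_diff powr_minus divide_inverse)
    finally have N2: "2 * r * (L / N) * (2 * (\<Sum>k<N. V k) + 1) \<le> 2 * L * (2 * C + 1) * (r powr \<gamma>)"
      unfolding \<gamma> .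
    have "2 * L * (2 * C + 1) * (r powr \<gamma>) * 1 \<le> 2 * L * (2 * C + 1) * (r powr \<gamma>) * (1 + ln r)"
      using r \<open>L > 0\<close> \<open>0 \<le> C\<close> by (intro mult_left_mono) auto
    moreover have "4 * (r powr \<gamma>) * (1 + ln r) = (2 * r powr \<gamma>) * (2 * (1 + ln r))" by simp
    ultimately have "N * (1 + ln N) + 2 * r * (L / N) * (2 * (\<Sum>k<N. V k) + 1)
        \<le> K * r powr \<gamma> * (1 + ln r)"
      using N1 N2 unfolding K_def distrib_right[of "4 * _"] distrib_right[of 4] by linarith
    moreover have "norm (Y L) \<le> exp (N * (1 + ln N) + 2 * r * (L / N) * (2 * (\<Sum>k<N. V k) + 1)) * norm (Y 0)"
      unfolding r_def by (rule canonical_solution_growth[OF \<open>L > 0\<close> ham rk sol N(3) V(1,2)])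
    ultimately show ?thesis
      unfolding r_def[symmetric] by (meson exp_le_cancel_iff mult_right_mono norm_ge_zero order_trans)
  qed
  moreover have "0 < K" using \<open>L > 0\<close> \<open>0 \<le> C\<close> by (auto simp: K_def intro!: add_pos_nonneg)
  ultimately show ?thesis using that unfolding \<gamma>_def by blast
qed

text \<open>All entries are at most \<open>B\<close>, so each of the two coordinates of
  \<open>A *v v\<close> is at most \<open>2 * B * norm v\<close>, and the norm is at most their sum.
  A constant factor such as 4 does not change the order.\<close>

lemma onorm_columns_le:
  fixes A :: "complex^2^2"
  assumes "\<And>j. norm (column j A) \<le> B"
  shows "onorm (\<lambda>v. A *v v) \<le> 4 * B"
proof (rule onorm_bound)
  show "0 \<le> 4 * B" using order_trans[OF norm_ge_zero assms] by simp
  have ent: "cmod (A $ i $ j) \<le> B" for i j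
    using Finite_Cartesian_Product.norm_nth_le[where x = "column j A" and i = i] assms[of j] by (simp add: column_def)
  fix v :: "complex^2"
  have "norm ((A *v v) $ i) \<le> 2 * B * norm v" for i
  proof -
    have "cmod (A $ i $ j * v $ j) \<le> B * norm v" for j
      unfolding norm_mult using ent[of i j] Finite_Cartesian_Product.norm_nth_le[where x = v and i = j]
      by (intro mult_mono) (auto intro: order_trans[OF norm_ge_zero])
    from this[of 1] this[of 2] have "cmod (A $ i $ 1 * v $ 1 + A $ i $ 2 * v $ 2) \<le> 2 * B * norm v"
      using norm_triangle_ineq[of "A $ i $ 1 * v $ 1" "A $ i $ 2 * v $ 2"] by linarith
    then show ?thesis by (simp add: matrix_vector_mult_def sum_2)
  qed
  from this[of 1] this[of 2] have "(\<Sum>i\<in>UNIV. norm ((A *v v) $ i)) \<le> 4 * B * norm v"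
    unfolding sum_2 by linarith
  moreover have "norm (A *v v) \<le> (\<Sum>i\<in>UNIV. norm ((A *v v) $ i))"
    unfolding norm_vec_def by (rule L2_set_le_sum) simp
  ultimately show "norm (A *v v) \<le> 4 * B * norm v" by linarith
qed

text \<open>The columns of \<open>M\<close> are solutions starting at unit vectors, so the uniform
  growth bound applies to each; entries and operator norm are controlled by the columns.\<close>

lemma oscillation_bound_order:
  assumes "L > 0" "hamiltonian H L" "AE x in lebesgue_on {0..L}. rank (H x) = 1"
    and M: "matrix_solution H L M"
    and \<beta>: "0 < \<beta>" "\<beta> \<le> 1" and "0 \<le> C" "oscillation_bound H L \<beta> C"
  shows "entire_order (\<lambda>z. M L z $ i $ j) \<le> ereal (1 / (1 + \<beta>))"
    and "matrix_order (\<lambda>z. M L z) \<le> ereal (1 / (1 + \<beta>))"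
proof -
  obtain K where "0 < K" and K: "\<And>z Y. canonical_solution H L z Y \<Longrightarrow> 1 \<le> norm z \<Longrightarrow>
      norm (Y L) \<le> exp (K * norm z powr (1 / (1 + \<beta>)) * (1 + ln (norm z))) * norm (Y 0)"
    using oscillation_bound_growth[OF assms(1-3) \<beta> assms(7,8)] by blast
  have col: "norm (column j (M L z)) \<le> exp (K * norm z powr (1 / (1 + \<beta>)) * (1 + ln (norm z)))"
    if "1 \<le> norm z" for j z
  proof -
    have "column j (M 0 z) = axis j 1"
      using M by (simp add: matrix_solution_def column_def axis_def mat_def vec_eq_iff eq_commute)
    then show ?thesis
      using K[of z "\<lambda>x. column j (M x z)"] M that by (simp add: matrix_solution_def)
  qed
  show "entire_order (\<lambda>z. M L z $ i $ j) \<le> ereal (1 / (1 + \<beta>))"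
    unfolding entire_order_def
  proof (rule growth_order_le)
    fix z :: complex assume z: "1 \<le> norm z"
    have "cmod (M L z $ i $ j) \<le> norm (column j (M L z))"
      using Finite_Cartesian_Product.norm_nth_le[where x = "column j (M L z)" and i = i] by (simp add: column_def)
    then show "cmod (M L z $ i $ j) \<le> exp (K * norm z powr (1 / (1 + \<beta>)) * (1 + ln (norm z)))"
      using col[OF z, of j] by linarith
  qed (use \<open>0 < K\<close> \<beta> in auto)
  show "matrix_order (\<lambda>z. M L z) \<le> ereal (1 / (1 + \<beta>))"
    unfolding matrix_order_def
  proof (rule growth_order_le)
    fix z :: complex assume z: "1 \<le> norm z"
    define t where "t = norm z powr (1 / (1 + \<beta>)) * (1 + ln (norm z))"
    have "1 \<le> norm z powr (1 / (1 + \<beta>))" using z \<beta> by (intro ge_one_powr_ge_zero) auto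
    then have t: "1 \<le> t" using z mult_mono[of 1 "norm z powr (1 / (1 + \<beta>))" 1 "1 + ln (norm z)"]
      by (simp add: t_def)
    have "onorm (\<lambda>v. M L z *v v) \<le> 4 * exp (K * t)"
      using onorm_columns_le[OF col[OF z]] by (simp add: t_def mult.assoc)
    \<comment> \<open>The factor 4 is absorbed through 4 <= 1 + 3 t <= exp (3 t), which raises
      \<open>K\<close> to \<open>K + 3\<close>.\<close>
    also have "\<dots> \<le> exp (3 * t) * exp (K * t)"
      using t by (intro mult_right_mono order_trans[OF _ exp_ge_add_one_self[of "3 * t"]]) auto
    also have "\<dots> = exp ((K + 3) * t)" by (simp add: algebra_simps flip: exp_add)
    finally show "onorm (\<lambda>v. M L z *v v) \<le> exp ((K + 3) * norm z powr (1 / (1 + \<beta>)) * (1 + ln (norm z)))"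
      by (simp add: t_def mult.assoc)
  qed (use \<open>0 < K\<close> \<beta> in auto)
qed

theorem corollary4:
  fixes H :: "real \<Rightarrow> real^2^2"
    and L :: real
    and M :: "real \<Rightarrow> complex \<Rightarrow> complex^2^2"
  assumes "L > 0"
    and "hamiltonian H L"
    and "AE x in lebesgue_on {0..L}. rank (H x) = 1"
    and "matrix_solution H L M"
  shows "(\<forall>\<alpha>::real. 0 < \<alpha> \<and> \<alpha> \<le> 1 \<and> hoelder_on \<alpha> {0..L} H \<longrightarrow>
            (\<forall>i j. entire_order (\<lambda>z. M L z $ i $ j) \<le> ereal (1 - \<alpha> / 2)) \<and>
            matrix_order (\<lambda>z. M L z) \<le> ereal (1 - \<alpha> / 2)) \<and>
         (bounded_variation_on 0 L H \<longrightarrow>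
            (\<forall>i j. entire_order (\<lambda>z. M L z $ i $ j) \<le> ereal (1 / 2)) \<and>
            matrix_order (\<lambda>z. M L z) \<le> ereal (1 / 2))"
proof (intro conjI allI impI)
  fix \<alpha> :: real assume \<alpha>: "0 < \<alpha> \<and> \<alpha> \<le> 1 \<and> hoelder_on \<alpha> {0..L} H"
  then obtain C where C: "0 \<le> C" "oscillation_bound H L \<alpha> C"
    using hoelder_oscillation_bound[OF assms(1)] by blast
  \<comment> \<open>This quantity is (1 - \<alpha>/2) (1 + \<alpha>) - 1, the slack between 1/(1 +
    \<alpha>) and the claimed bound; it vanishes at \<alpha> = 1.\<close>
  have "0 \<le> \<alpha> * (1 - \<alpha>) / 2" using \<alpha> by simp
  then have "1 \<le> (1 - \<alpha> / 2) * (1 + \<alpha>)" by (simp add: field_simps)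
  then have le: "ereal (1 / (1 + \<alpha>)) \<le> ereal (1 - \<alpha> / 2)"
    using \<alpha> by (simp add: divide_le_eq)
  show "entire_order (\<lambda>z. M L z $ i $ j) \<le> ereal (1 - \<alpha> / 2)" for i j
    using oscillation_bound_order(1)[OF assms _ _ C] \<alpha> le order_trans by blast
  show "matrix_order (\<lambda>z. M L z) \<le> ereal (1 - \<alpha> / 2)"
    using oscillation_bound_order(2)[OF assms _ _ C] \<alpha> le order_trans by blast
next
  assume "bounded_variation_on 0 L H"
  then obtain C where C: "0 \<le> C" "oscillation_bound H L 1 C"
    using bounded_variation_oscillation_bound[OF assms(1)] by blast
  show "entire_order (\<lambda>z. M L z $ i $ j) \<le> ereal (1 / 2)" for i j
    using oscillation_bound_order(1)[OF assms _ _ C] by simp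
  show "matrix_order (\<lambda>z. M L z) \<le> ereal (1 / 2)"
    using oscillation_bound_order(2)[OF assms _ _ C] by simp
qed

end
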